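(* Let $V_\infty=\bigoplus_{k=0}^\infty V_k$ and let $S\colon V_\infty\to V_\infty$, $S\left((x_k)_{k=0}^\infty\right)=(0,A_0x_0,A_1x_1,A_2x_2,\dots)$. Then: (1) The adjoint $S^*\colon V_\infty\to V_\infty$ is given by $S^*\left((x_k)_{k\in\mathbb{N}}\right)=\left(A_0^*(x_1),A_1^*(x_2),A_2^*(x_3),\dots\right)$ for all $(x_k)_{k\in\mathbb{N}}\in V_\infty$. (2) $S$ is left unitary, that is $S^*S=\mathrm{id}_{V_\infty}$. (3) $S$ is an isometric embedding.
   Context: $\mathbb{N}=\{0,1,2,\dots\}$. For any positive integer $m$ and $k\in\mathbb{N}$, $\omega_{m,k}=\exp\left(\frac{(2m-1)\pi i}{2^k}\right)$, and $\Omega_{m,k}\colon\mathbb{N}\to\mathbb{C}$ is the function $\Omega_{m,k}(n)=\omega_{m,k}^n$; both depend only on $m$ modulo $2^k$. $V_k$ is the complex vector space of functions spanned by $\Omega_{1,k},\dots,\Omega_{2^k,k}$ (which are linearly independent), with the inner product making $(\Omega_{j,k})_{j=1}^{2^k}$ an orthonormal basis. $A_k\colon V_k\to V_{k+1}$ is the linear operator with $$A_k(\Omega_{j,k})=\tfrac12\Omega_{j,k+1}+\tfrac{\omega_{j,k+1}}{2}\Omega_{3j-1,k+1}+\tfrac12\Omega_{2^k+j,k+1}-\tfrac{\omega_{j,k+1}}{2}\Omega_{2^k+3j-1,k+1},\quad j=1,\dots,2^k.$$ (For positive integers $n$, $A_k(\Omega_{j,k})(n)=\omega_{j,k}^{T(n)}$,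 where $T$ is the Collatz map $T(n)=n/2$ for $n$ even, $T(n)=(3n+1)/2$ for $n$ odd.) $V_\infty$ is the Hilbert space direct sum: sequences $(x_k)$ with $x_k\in V_k$ and $\sum_k\|x_k\|^2<\infty$, with $\langle x,y\rangle=\sum_k\langle x_k,y_k\rangle$. *)

theory Defs
  imports "HOL-Analysis.Analysis" "HOL-Library.Function_Algebras"
begin

definition omega :: "nat \<Rightarrow> nat \<Rightarrow> complex" where
  "omega m k = exp ((2 * of_nat m - 1) * of_real pi * \<i> / 2 ^ k)"

definition Omega :: "nat \<Rightarrow> nat \<Rightarrow> nat \<Rightarrow> complex" where
  "Omega m k = (\<lambda>n. omega m k ^ n)"

definition cscale :: "complex \<Rightarrow> (nat \<Rightarrow> complex) \<Rightarrow> nat \<Rightarrow> complex" where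
  "cscale c f = (\<lambda>n. c * f n)"

interpretation cfun: vector_space cscale
  by unfold_locales (auto simp: cscale_def fun_eq_iff algebra_simps)

definition V :: "nat \<Rightarrow> (nat \<Rightarrow> complex) set" where
  "V k = cfun.span ((\<lambda>j. Omega j k) ` {1..2 ^ k})"

text \<open>The library's \<open>representation\<close> is identically 0 for a dependent set and for vectors
  outside the span; \<open>Omega_independent\<close> below shows that it gives the coordinates on \<open>V k\<close>.\<close>

definition coord :: "nat \<Rightarrow> nat \<Rightarrow> (nat \<Rightarrow> complex) \<Rightarrow> complex" where
  "coord k j f = cfun.representation ((\<lambda>j. Omega j k) ` {1..2 ^ k}) f (Omega j k)"

definition inner_V :: "nat \<Rightarrow> (nat \<Rightarrow> complex) \<Rightarrow> (nat \<Rightarrow> complex) \<Rightarrow> complex" where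
  "inner_V k f g = (\<Sum>j=1..2 ^ k. coord k j f * cnj (coord k j g))"

definition A_op :: "nat \<Rightarrow> (nat \<Rightarrow> complex) \<Rightarrow> nat \<Rightarrow> complex" where
  "A_op k f = (\<Sum>j=1..2 ^ k. cscale (coord k j f)
     (cscale (1 / 2) (Omega j (k + 1))
      + cscale (omega j (k + 1) / 2) (Omega (3 * j - 1) (k + 1))
      + cscale (1 / 2) (Omega (2 ^ k + j) (k + 1))
      - cscale (omega j (k + 1) / 2) (Omega (2 ^ k + 3 * j - 1) (k + 1))))"

lemma omega_cis: "omega m k = cis ((2 * real m - 1) * pi / 2 ^ k)"
  by (simp add: omega_def cis_conv_exp algebra_simps)

lemma sum_Omega_orthogonal:
  assumes "j \<in> {1..2 ^ k}" "l \<in> {1..2 ^ k}"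
  shows "(\<Sum>n<2 ^ k. Omega j k n * cnj (Omega l k n)) = (if j = l then 2 ^ k else 0)"
proof -
  define w where "w = cis (2 * pi * ((real j - real l) / 2 ^ k))"
  have w: "omega j k * cnj (omega l k) = w"
    by (simp add: omega_cis w_def cis_cnj cis_mult)
       (rule arg_cong[where f = cis], simp add: field_simps)
  have s: "(\<Sum>n<2 ^ k. Omega j k n * cnj (Omega l k n)) = (\<Sum>n<2 ^ k. w ^ n)"
    by (simp add: Omega_def flip: w power_mult_distrib)
  show ?thesis
  proof (cases "j = l")
    case True
    then show ?thesis using s by (simp add: w_def)
  next
    case False
    have "w \<noteq> 1"
    proof
      assume "w = 1"
      then have "cos (2 * pi * ((real j - real l) / 2 ^ k)) = 1"
        by (simp add: w_def complex_eq_iff)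
      then obtain z :: int where "2 * pi * ((real j - real l) / 2 ^ k) = of_int z * 2 * pi"
        using cos_one_2pi_int by blast
      then have "(2 * pi) * ((real j - real l) / 2 ^ k) = (2 * pi) * of_int z"
        by (simp only: mult_ac)
      then have "(real j - real l) / 2 ^ k = of_int z"
        unfolding mult_cancel_left by simp
      then have "real j - real l = of_int z * 2 ^ k"
        by (simp add: divide_eq_eq)
      then have "real_of_int (int j - int l) = real_of_int (z * 2 ^ k)"
        by simp
      then have e: "int j - int l = z * 2 ^ k"
        using of_int_eq_iff by blast
      have "int i \<le> 2 ^ k" if "i \<in> {1..2 ^ k}" for i :: nat
        using that of_nat_mono[of i "2 ^ k", where 'a = int] by simp
      from this[OF assms(1)] this[OF assms(2)]
      have "int j \<le> 2 ^ k" "int l \<le> 2 ^ k" .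
      moreover have "1 \<le> int j" "1 \<le> int l"
        using assms by auto
      ultimately
      have "\<bar>int j - int l\<bar> < 2 ^ k"
        by linarith
      then have "\<bar>z\<bar> * 2 ^ k < 1 * (2 ^ k :: int)"
        by (simp add: e abs_mult)
      then have "z = 0"
        by (simp only: mult_less_cancel_right) auto
      then show False using e False by simp
    qed
    moreover have "w ^ (2 ^ k) = 1"
    proof -
      have "w ^ (2 ^ k) = cis (2 * pi * of_int (int j - int l))"
        unfolding w_def Complex.DeMoivre by (rule arg_cong[where f = cis]) simp
      also have "\<dots> = 1" by (rule cis_multiple_2pi) simp
      finally show ?thesis .
    qed
    ultimately show ?thesis using s False by (simp add: geometric_sum)
  qed
qed

lemma inj_on_Omega: "inj_on (\<lambda>j. Omega j k) {1..2 ^ k}"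
proof (rule inj_onI)
  fix j l assume h: "j \<in> {1..2 ^ k}" "l \<in> {1..2 ^ k}" "Omega j k = Omega l k"
  have "(if j = l then 2 ^ k else 0) = (2 ^ k :: complex)"
    using sum_Omega_orthogonal[OF h(1,2)] sum_Omega_orthogonal[OF h(2,2)]
    unfolding h(3) by simp
  then show "j = l"
    by (cases "j = l") simp_all
qed

lemma Omega_independent: "cfun.independent ((\<lambda>j. Omega j k) ` {1..2 ^ k})"
proof (rule cfun.independent_if_scalars_zero)
  show "finite ((\<lambda>j. Omega j k) ` {1..2 ^ k})" by simp
  fix c and v
  assume z: "(\<Sum>x\<in>(\<lambda>j. Omega j k) ` {1..2 ^ k}. cscale (c x) x) = 0"
    and "v \<in> (\<lambda>j. Omega j k) ` {1..2 ^ k}"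
  then obtain l where l: "l \<in> {1..2 ^ k}" "v = Omega l k" by blast
  have sum_apply: "sum F I n = (\<Sum>j\<in>I. F j n)" for F :: "nat \<Rightarrow> nat \<Rightarrow> complex" and I n
    by (induction I rule: infinite_finite_induct) auto
  have z': "(\<Sum>j=1..2 ^ k. c (Omega j k) * Omega j k n) = 0" for n
    using fun_cong[OF z[unfolded sum.reindex[OF inj_on_Omega] o_def], of n]
    by (simp add: sum_apply cscale_def)
  have "0 = (\<Sum>n<2 ^ k. (\<Sum>j=1..2 ^ k. c (Omega j k) * Omega j k n) * cnj (Omega l k n))"
    by (simp only: z') simp
  also have "\<dots> = (\<Sum>j=1..2 ^ k. c (Omega j k) * (\<Sum>n<2 ^ k. Omega j k n * cnj (Omega l k n)))"
    by (simp only: sum_distrib_left sum_distrib_right mult.assoc) (rule sum.swap)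
  also have "\<dots> = (\<Sum>j=1..2 ^ k. if j = l then c (Omega j k) * 2 ^ k else 0)"
    using l by (intro sum.cong refl) (simp add: sum_Omega_orthogonal)
  also have "\<dots> = c v * 2 ^ k" using l by simp
  finally show "c v = 0" by simp
qed

lemma coord_Omega:
  assumes "j \<in> {1..2 ^ k}" "l \<in> {1..2 ^ k}"
  shows "coord k l (Omega j k) = (if l = j then 1 else 0)"
proof -
  have "coord k l (Omega j k) = (if Omega l k = Omega j k then 1 else 0)"
    unfolding coord_def
    using assms by (subst cfun.representation_basis[OF Omega_independent]) auto
  then show ?thesis
    using assms inj_onD[OF inj_on_Omega[of k]] by auto
qed

lemma inner_V_Omega:
  assumes "j \<in> {1..2 ^ k}" "l \<in> {1..2 ^ k}"
  shows "inner_V k (Omega j k) (Omega l k) = (if j = l then 1 else 0)"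
proof -
  have "inner_V k (Omega j k) (Omega l k)
      = (\<Sum>i=1..2 ^ k. if i = j then (if j = l then 1 else 0) else 0)"
    unfolding inner_V_def using assms by (intro sum.cong refl) (simp add: coord_Omega)
  then show ?thesis using assms by simp
qed

lemma A_op_Omega:
  assumes "j \<in> {1..2 ^ k}"
  shows "A_op k (Omega j k) = cscale (1 / 2) (Omega j (k + 1))
      + cscale (omega j (k + 1) / 2) (Omega (3 * j - 1) (k + 1))
      + cscale (1 / 2) (Omega (2 ^ k + j) (k + 1))
      - cscale (omega j (k + 1) / 2) (Omega (2 ^ k + 3 * j - 1) (k + 1))" (is "_ = ?R j")
proof -
  have cs: "cscale (if P then 1 else 0) f = (if P then f else 0)" for P f
    by simp
  have "A_op k (Omega j k) = (\<Sum>i=1..2 ^ k. cscale (if i = j then 1 else 0) (?R i))"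
    unfolding A_op_def using assms by (intro sum.cong refl) (simp only: coord_Omega)
  also have "\<dots> = (\<Sum>i=1..2 ^ k. if i = j then ?R i else 0)"
    by (simp only: cs)
  also have "\<dots> = ?R j"
    using assms by (subst sum.delta) simp_all
  finally show ?thesis .
qed


definition linear_on ::
  "'a::ab_group_add set \<Rightarrow> (complex \<Rightarrow> 'a \<Rightarrow> 'a) \<Rightarrow> (complex \<Rightarrow> 'b::ab_group_add \<Rightarrow> 'b)
    \<Rightarrow> ('a \<Rightarrow> 'b) \<Rightarrow> bool" where
  "linear_on H sH sK T \<longleftrightarrow>
     (\<forall>x\<in>H. \<forall>y\<in>H. T (x + y) = T x + T y) \<and> (\<forall>c. \<forall>x\<in>H. T (sH c x) = sK c (T x))"

definition ip_norm :: "('a \<Rightarrow> 'a \<Rightarrow> complex) \<Rightarrow> 'a \<Rightarrow> real" where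
  "ip_norm ip x = sqrt (Re (ip x x))"

definition is_adjoint_on ::
  "'a set \<Rightarrow> ('a \<Rightarrow> 'a \<Rightarrow> complex) \<Rightarrow> 'b set \<Rightarrow> ('b \<Rightarrow> 'b \<Rightarrow> complex)
    \<Rightarrow> ('a \<Rightarrow> 'b) \<Rightarrow> ('b \<Rightarrow> 'a) \<Rightarrow> bool" where
  "is_adjoint_on H ipH K ipK T T' \<longleftrightarrow>
     T \<in> H \<rightarrow> K \<and> T' \<in> K \<rightarrow> H \<and> (\<forall>x\<in>H. \<forall>y\<in>K. ipK (T x) y = ipH x (T' y))"

text \<open>The value is meaningful only if such a \<open>z\<close> exists, i.e. if \<open>is_adjoint_on\<close> holds for
  the resulting operator.\<close>

definition adjoint_on ::
  "'a set \<Rightarrow> ('a \<Rightarrow> 'a \<Rightarrow> complex) \<Rightarrow> 'b set \<Rightarrow> ('b \<Rightarrow> 'b \<Rightarrow> complex)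
    \<Rightarrow> ('a \<Rightarrow> 'b) \<Rightarrow> 'b \<Rightarrow> 'a" where
  "adjoint_on H ipH K ipK T y = (THE z. z \<in> H \<and> (\<forall>x\<in>H. ipK (T x) y = ipH x z))"

definition isometric_embedding_on ::
  "'a::ab_group_add set \<Rightarrow> (complex \<Rightarrow> 'a \<Rightarrow> 'a) \<Rightarrow> ('a \<Rightarrow> 'a \<Rightarrow> complex)
    \<Rightarrow> 'b::ab_group_add set \<Rightarrow> (complex \<Rightarrow> 'b \<Rightarrow> 'b) \<Rightarrow> ('b \<Rightarrow> 'b \<Rightarrow> complex)
    \<Rightarrow> ('a \<Rightarrow> 'b) \<Rightarrow> bool" where
  "isometric_embedding_on H sH ipH K sK ipK T \<longleftrightarrow>
     T \<in> H \<rightarrow> K \<and> linear_on H sH sK T \<and>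
     (\<forall>x\<in>H. \<forall>y\<in>H. ip_norm ipK (T x - T y) = ip_norm ipH (x - y))"


definition V_inf :: "(nat \<Rightarrow> nat \<Rightarrow> complex) set" where
  "V_inf = {x. (\<forall>k. x k \<in> V k) \<and> summable (\<lambda>k. (ip_norm (inner_V k) (x k))\<^sup>2)}"

definition scale_inf :: "complex \<Rightarrow> (nat \<Rightarrow> nat \<Rightarrow> complex) \<Rightarrow> nat \<Rightarrow> nat \<Rightarrow> complex" where
  "scale_inf c x = (\<lambda>k. cscale c (x k))"

definition inner_inf :: "(nat \<Rightarrow> nat \<Rightarrow> complex) \<Rightarrow> (nat \<Rightarrow> nat \<Rightarrow> complex) \<Rightarrow> complex" where
  "inner_inf x y = (\<Sum>k. inner_V k (x k) (y k))"

definition S_op :: "(nat \<Rightarrow> nat \<Rightarrow> complex) \<Rightarrow> nat \<Rightarrow> nat \<Rightarrow> complex" where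
  "S_op x = (\<lambda>k. case k of 0 \<Rightarrow> 0 | Suc m \<Rightarrow> A_op m (x m))"

definition A_adj :: "nat \<Rightarrow> (nat \<Rightarrow> complex) \<Rightarrow> nat \<Rightarrow> complex" where
  "A_adj k = adjoint_on (V k) (inner_V k) (V (k + 1)) (inner_V (k + 1)) (A_op k)"

definition S_adj :: "(nat \<Rightarrow> nat \<Rightarrow> complex) \<Rightarrow> nat \<Rightarrow> nat \<Rightarrow> complex" where
  "S_adj = adjoint_on V_inf inner_inf V_inf inner_inf S_op"

end

theory Submission
  imports Defs "HOL-Number_Theory.Cong"
begin

text \<open>
  The reason behind everything is that the Collatz map \<open>T\<close> preserves the uniform measure on
  residue classes.

  On \<open>V k\<close> the inner product, defined by coordinates, is also an average of values:
  \<open>\<langle>f, g\<rangle>\<close> is the mean of \<open>f n * cnj (g n)\<close> over \<open>n < 2 ^ k\<close> (Plancherel for the characters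
  \<open>Omega j k\<close>, lemma \<open>inner_V_eq_average\<close>).  In the same picture the operator \<open>A_op k\<close> is
  composition with \<open>T\<close> (lemma \<open>A_op_eq_comp\<close>).  Functions in \<open>V k\<close> change sign under translation
  by \<open>2 ^ k\<close>, hence \<open>h n = f n * cnj (g n)\<close> depends only on \<open>n\<close> modulo \<open>2 ^ k\<close>.  Among the
  \<open>n < 2 ^ (k + 1)\<close> the even ones \<open>2 * m\<close> are sent by \<open>T\<close> to \<open>m\<close>, the odd ones \<open>2 * m + 1\<close> to
  \<open>3 * m + 2\<close>, and both families run exactly once through the residues modulo \<open>2 ^ k\<close> because \<open>3\<close>
  is odd.  So the mean of \<open>h \<circ> T\<close> over \<open>n < 2 ^ (k + 1)\<close> is the mean of \<open>h\<close> over \<open>n < 2 ^ k\<close>: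
  \<open>A_op k\<close> is an isometry (lemma \<open>A_op_isometry\<close>).

  The rest is Hilbert space theory.  Each \<open>A_op k\<close> has an adjoint because \<open>V k\<close> has a finite
  orthonormal basis; the adjoint of an isometry is a left inverse and a contraction.  Being
  contractions, the \<open>A_adj k\<close> assemble to an operator on the direct sum, which is the adjoint of
  the shifted sum of the \<open>A_op k\<close>; the remaining claims then hold component by component.
\<close>

section \<open>The spaces of exponential functions\<close>

lemma sum_fun_apply: "(\<Sum>i\<in>I. F i) n = (\<Sum>i\<in>I. F i n)"
  for F :: "'i \<Rightarrow> nat \<Rightarrow> complex"
  by (induction I rule: infinite_finite_induct) auto

lemma V_add: "f \<in> V k \<Longrightarrow> g \<in> V k \<Longrightarrow> f + g \<in> V k"
  unfolding V_def by (rule cfun.span_add)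

lemma V_diff: "f \<in> V k \<Longrightarrow> g \<in> V k \<Longrightarrow> f - g \<in> V k"
  unfolding V_def by (rule cfun.span_diff)

lemma V_scale: "f \<in> V k \<Longrightarrow> cscale c f \<in> V k"
  unfolding V_def by (rule cfun.span_scale)

lemma V_zero: "0 \<in> V k"
  unfolding V_def by (rule cfun.span_zero)

lemma V_sum: "(\<And>i. i \<in> I \<Longrightarrow> F i \<in> V k) \<Longrightarrow> sum F I \<in> V k"
  unfolding V_def by (rule cfun.span_sum)

lemma omega_add_period: "omega (m + 2 ^ k) k = omega m k"
proof -
  have "(2 * real (m + 2 ^ k) - 1) * pi / 2 ^ k = (2 * real m - 1) * pi / 2 ^ k + 2 * pi"
    by (simp add: field_simps)
  then show ?thesis
    unfolding omega_cis by (simp flip: cis_mult)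
qed

lemma Omega_add_period: "Omega (m + 2 ^ k) k = Omega m k"
  by (simp add: Omega_def omega_add_period)

text \<open>The formula for \<open>A_op\<close> uses indices beyond \<open>2 ^ (k + 1)\<close>; periodicity brings them back
  to the basis.\<close>

lemma Omega_in_V:
  assumes "1 \<le> m"
  shows "Omega m k \<in> V k"
  using assms
proof (induction m rule: less_induct)
  case (less m)
  show ?case
  proof (cases "m \<le> 2 ^ k")
    case True
    with less.prems show ?thesis
      unfolding V_def by (intro cfun.span_base) auto
  next
    case False
    then have "Omega (m - 2 ^ k) k \<in> V k"
      by (intro less.IH) auto
    with False show ?thesis
      using Omega_add_period[of "m - 2 ^ k" k] by simp
  qed
qed

lemma V_expansion:
  assumes "f \<in> V k"
  shows "f n = (\<Sum>j=1..2 ^ k. coord k j f * Omega j k n)"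
proof -
  let ?B = "(\<lambda>j. Omega j k) ` {1..2 ^ k}"
  have "f = (\<Sum>b\<in>?B. cscale (cfun.representation ?B f b) b)"
    using cfun.sum_representation_eq[OF Omega_independent, of f k ?B] assms
    by (simp add: V_def)
  also have "\<dots> = (\<Sum>j=1..2 ^ k. cscale (coord k j f) (Omega j k))"
    by (simp only: sum.reindex[OF inj_on_Omega] coord_def o_def)
  finally have "f n = (\<Sum>j=1..2 ^ k. cscale (coord k j f) (Omega j k)) n"
    by (rule fun_cong)
  then show ?thesis
    by (simp add: sum_fun_apply cscale_def)
qed

lemma coord_fourier:
  assumes "f \<in> V k" and l: "l \<in> {1..2 ^ k}"
  shows "(\<Sum>n<2 ^ k. f n * cnj (Omega l k n)) = 2 ^ k * coord k l f"
proof -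
  have "(\<Sum>n<2 ^ k. f n * cnj (Omega l k n))
      = (\<Sum>n<2 ^ k. \<Sum>j=1..2 ^ k. coord k j f * (Omega j k n * cnj (Omega l k n)))"
    by (simp only: V_expansion[OF assms(1)] sum_distrib_right mult.assoc)
  also have "\<dots> = (\<Sum>j=1..2 ^ k. coord k j f * (\<Sum>n<2 ^ k. Omega j k n * cnj (Omega l k n)))"
    by (simp only: sum_distrib_left) (rule sum.swap)
  also have "\<dots> = (\<Sum>j=1..2 ^ k. if j = l then coord k j f * 2 ^ k else 0)"
    using l by (intro sum.cong refl) (simp add: sum_Omega_orthogonal)
  also have "\<dots> = 2 ^ k * coord k l f"
    using l by simp
  finally show ?thesis .
qed

text \<open>Plancherel: reading the inner product off values makes it visibly sesquilinear and turns
  the isometry of \<open>A_op\<close> into a statement about how the Collatz map distributes residues.\<close>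

lemma inner_V_eq_average:
  assumes "f \<in> V k" "g \<in> V k"
  shows "inner_V k f g = (\<Sum>n<2 ^ k. f n * cnj (g n)) / 2 ^ k"
proof -
  have "(\<Sum>n<2 ^ k. f n * cnj (g n))
      = (\<Sum>n<2 ^ k. \<Sum>l=1..2 ^ k. cnj (coord k l g) * (f n * cnj (Omega l k n)))"
    by (simp only: V_expansion[OF assms(2)] cnj_sum complex_cnj_mult sum_distrib_left mult_ac)
  also have "\<dots> = (\<Sum>l=1..2 ^ k. cnj (coord k l g) * (\<Sum>n<2 ^ k. f n * cnj (Omega l k n)))"
    by (simp only: sum_distrib_left) (rule sum.swap)
  also have "\<dots> = (\<Sum>l=1..2 ^ k. cnj (coord k l g) * (2 ^ k * coord k l f))"
    by (intro sum.cong refl) (simp only: coord_fourier[OF assms(1)])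
  also have "\<dots> = 2 ^ k * inner_V k f g"
    by (simp add: inner_V_def sum_distrib_left mult_ac)
  finally show ?thesis by simp
qed

lemma inner_V_Omega_right:
  assumes "f \<in> V k" "j \<in> {1..2 ^ k}"
  shows "inner_V k f (Omega j k) = coord k j f"
  using assms by (simp add: inner_V_eq_average Omega_in_V coord_fourier)

lemma inner_V_commute: "inner_V k g f = cnj (inner_V k f g)"
  by (simp add: inner_V_def mult.commute)

lemma inner_V_diff:
  assumes "f \<in> V k" "g \<in> V k"
  shows "inner_V k (f - g) (f - g)
    = inner_V k f f - inner_V k f g - inner_V k g f + inner_V k g g"
proof -
  have "(\<Sum>n<2 ^ k. (f - g) n * cnj ((f - g) n))
      = (\<Sum>n<2 ^ k. f n * cnj (f n) - f n * cnj (g n) - g n * cnj (f n) + g n * cnj (g n))"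
    by (intro sum.cong refl) (simp add: algebra_simps)
  then show ?thesis
    unfolding inner_V_eq_average[OF V_diff[OF assms] V_diff[OF assms]]
    using assms by (simp add: inner_V_eq_average sum.distrib sum_subtractf add_divide_distrib
        diff_divide_distrib)
qed

lemma V_eqI:
  assumes f: "f \<in> V k" and g: "g \<in> V k"
    and eq: "\<And>j. j \<in> {1..2 ^ k} \<Longrightarrow> inner_V k (Omega j k) f = inner_V k (Omega j k) g"
  shows "f = g"
proof
  fix n
  have "coord k j f = coord k j g" if j: "j \<in> {1..2 ^ k}" for j
  proof -
    have "coord k j f = cnj (inner_V k (Omega j k) f)"
      by (rule inner_V_Omega_right[OF f j, unfolded inner_V_commute[of k f], symmetric])
    also have "\<dots> = cnj (inner_V k (Omega j k) g)"
      by (simp only: eq[OF j])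
    also have "\<dots> = coord k j g"
      by (rule inner_V_Omega_right[OF g j, unfolded inner_V_commute[of k g]])
    finally show ?thesis .
  qed
  then have "(\<Sum>j=1..2 ^ k. coord k j f * Omega j k n) = (\<Sum>j=1..2 ^ k. coord k j g * Omega j k n)"
    by (intro sum.cong refl) metis
  then show "f n = g n"
    by (simp only: V_expansion[OF f] V_expansion[OF g])
qed

lemma inner_V_self: "inner_V k f f = of_real (\<Sum>j=1..2 ^ k. (cmod (coord k j f))\<^sup>2)"
  by (simp add: inner_V_def flip: complex_norm_square)

lemma ip_norm_sq: "(ip_norm (inner_V k) f)\<^sup>2 = Re (inner_V k f f)"
  by (simp add: ip_norm_def inner_V_self sum_nonneg)

lemma ip_norm_sq_eq_average:
  assumes "f \<in> V k"
  shows "(ip_norm (inner_V k) f)\<^sup>2 = (\<Sum>n<2 ^ k. (cmod (f n))\<^sup>2) / 2 ^ k"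
proof -
  have "inner_V k f f = of_real ((\<Sum>n<2 ^ k. (cmod (f n))\<^sup>2) / 2 ^ k)"
    using assms by (simp add: inner_V_eq_average flip: complex_norm_square)
  then show ?thesis
    by (simp add: ip_norm_sq)
qed

text \<open>This weak form of the Cauchy-Schwarz inequality is what makes the series defining
  \<open>inner_inf\<close> converge.\<close>

lemma norm_inner_V_le:
  "cmod (inner_V k f g) \<le> (ip_norm (inner_V k) f)\<^sup>2 + (ip_norm (inner_V k) g)\<^sup>2"
proof -
  have ab: "a * b \<le> a\<^sup>2 + b\<^sup>2" for a b :: real
    using sum_squares_bound[of a b] zero_le_power2[of a] zero_le_power2[of b] by linarith
  have "cmod (inner_V k f g) \<le> (\<Sum>j=1..2 ^ k. cmod (coord k j f) * cmod (coord k j g))"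
    unfolding inner_V_def by (rule order_trans[OF norm_sum]) (simp add: norm_mult)
  also have "\<dots> \<le> (\<Sum>j=1..2 ^ k. (cmod (coord k j f))\<^sup>2 + (cmod (coord k j g))\<^sup>2)"
    by (intro sum_mono ab)
  finally show ?thesis
    by (simp add: ip_norm_sq inner_V_self sum.distrib)
qed

section \<open>Composition with the Collatz map\<close>

definition collatz :: "nat \<Rightarrow> nat" where
  "collatz n = (if even n then n div 2 else (3 * n + 1) div 2)"

lemma collatz_double: "collatz (2 * m) = m"
  by (simp add: collatz_def)

lemma collatz_double_Suc: "collatz (Suc (2 * m)) = 3 * m + 2"
  by (simp add: collatz_def)

text \<open>The numbers \<open>omega m k\<close> are the roots of \<open>z ^ (2 ^ k) = - 1\<close>; hence functions in \<open>V k\<close>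
  change sign under translation by \<open>2 ^ k\<close>.\<close>

lemma omega_power_two_power: "omega m k ^ (2 ^ k) = - 1"
proof -
  have "omega m k ^ (2 ^ k) = cis (2 * pi * of_int (int m) - pi)"
    unfolding omega_cis Complex.DeMoivre
    by (rule arg_cong[where f = cis]) (simp add: field_simps)
  also have "\<dots> = cis (2 * pi * of_int (int m)) * cis (- pi)"
    unfolding cis_mult by simp
  also have "\<dots> = - 1"
    by (subst cis_multiple_2pi) (simp_all flip: cis_inverse)
  finally show ?thesis .
qed

text \<open>With \<open>a = omega j (k + 1)\<close> the four exponentials in \<open>A_op k (Omega j k)\<close> have the bases \<open>a\<close>,
  \<open>a ^ 3\<close>, \<open>-a\<close> and \<open>-a ^ 3\<close>.  At even arguments the cubes cancel and at odd arguments the other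
  two do, leaving a single power of \<open>a\<^sup>2 = omega j k\<close>.\<close>

lemma A_op_terms_eq_Omega_collatz:
  assumes "1 \<le> j"
  shows "(cscale (1 / 2) (Omega j (k + 1))
      + cscale (omega j (k + 1) / 2) (Omega (3 * j - 1) (k + 1))
      + cscale (1 / 2) (Omega (2 ^ k + j) (k + 1))
      - cscale (omega j (k + 1) / 2) (Omega (2 ^ k + 3 * j - 1) (k + 1))) n
    = Omega j k (collatz n)"
proof -
  define a where "a = omega j (k + 1)"
  have half: "omega (2 ^ k + m) (k + 1) = - omega m (k + 1)" for m
  proof -
    have "(2 * real (2 ^ k + m) - 1) * pi / 2 ^ (k + 1) = (2 * real m - 1) * pi / 2 ^ (k + 1) + pi"
      by (simp add: field_simps)
    then show ?thesis
      unfolding omega_cis by (simp flip: cis_mult)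
  qed
  have sq: "omega j k = a\<^sup>2"
    unfolding a_def omega_cis Complex.DeMoivre
    by (rule arg_cong[where f = cis]) (simp add: field_simps)
  have cube: "omega (3 * j - 1) (k + 1) = a ^ 3"
    unfolding a_def omega_cis Complex.DeMoivre
    using assms by (intro arg_cong[where f = cis]) (simp add: field_simps of_nat_diff)
  have ncube: "omega (2 ^ k + 3 * j - 1) (k + 1) = - (a ^ 3)"
    using half[of "3 * j - 1"] assms cube by simp
  have "(1 / 2) * a ^ n + (a / 2) * (a ^ 3) ^ n + (1 / 2) * (- a) ^ n - (a / 2) * (- (a ^ 3)) ^ n
      = (a\<^sup>2) ^ collatz n"
  proof (cases "even n")
    case True
    then obtain m where "n = 2 * m" by (elim evenE)
    then show ?thesis
      by (simp only: collatz_double) (simp add: power_mult)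
  next
    case False
    then obtain m where n: "n = Suc (2 * m)" by (elim oddE) simp
    have "a * (a ^ 3) ^ Suc (2 * m) = a ^ (1 + 3 * Suc (2 * m))"
      by (simp only: power_add power_mult power_one_right)
    also have "1 + 3 * Suc (2 * m) = 2 * (3 * m + 2)"
      by simp
    finally have "a * (a ^ 3) ^ Suc (2 * m) = (a\<^sup>2) ^ (3 * m + 2)"
      by (simp only: power_mult)
    moreover have "(- a) ^ n = - (a ^ n)" "(- (a ^ 3)) ^ n = - ((a ^ 3) ^ n)"
      using False by (simp_all add: power_minus_odd)
    ultimately show ?thesis
      by (simp only: n collatz_double_Suc) simp
  qed
  then show ?thesis
    by (simp only: cscale_def Omega_def sq cube ncube half fun_diff_def plus_fun_def flip: a_def)
qed

lemma A_op_eq_comp: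
  assumes "f \<in> V k"
  shows "A_op k f = f \<circ> collatz"
proof
  fix n
  have "A_op k f n = (\<Sum>j=1..2 ^ k. coord k j f * Omega j k (collatz n))"
    unfolding A_op_def sum_fun_apply
    by (intro sum.cong refl, subst cscale_def, subst A_op_terms_eq_Omega_collatz) auto
  then show "A_op k f n = (f \<circ> collatz) n"
    by (simp add: V_expansion[OF assms])
qed

lemma A_op_in_V: "A_op k f \<in> V (k + 1)"
  unfolding A_op_def
  by (intro V_sum V_scale V_diff V_add Omega_in_V) auto

lemma A_op_add:
  assumes "f \<in> V k" "g \<in> V k"
  shows "A_op k (f + g) = A_op k f + A_op k g"
  using assms by (simp add: A_op_eq_comp V_add fun_eq_iff)

lemma A_op_diff:
  assumes "f \<in> V k" "g \<in> V k"
  shows "A_op k (f - g) = A_op k f - A_op k g"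
  using assms by (simp add: A_op_eq_comp V_diff fun_eq_iff)

lemma A_op_scale:
  assumes "f \<in> V k"
  shows "A_op k (cscale c f) = cscale c (A_op k f)"
  using assms by (simp add: A_op_eq_comp V_scale) (simp add: cscale_def fun_eq_iff)

lemma V_antiperiodic:
  assumes "f \<in> V k"
  shows "f (n + 2 ^ k) = - f n"
  by (simp add: V_expansion[OF assms] Omega_def power_add omega_power_two_power sum_negf)

lemma periodic_mod:
  fixes h :: "nat \<Rightarrow> 'a"
  assumes "\<And>n. h (n + N) = h n"
  shows "h (n mod N) = h n"
proof -
  have "h (m + q * N) = h m" for m q
  proof (induction q)
    case (Suc q)
    then show ?case
      using assms[of "m + q * N"] by (simp add: ac_simps)
  qed simp
  from this[of "n mod N" "n div N"] show ?thesis
    by simp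
qed

lemma bij_betw_affine_mod:
  fixes a c N :: nat
  assumes "coprime a N" "0 < N"
  shows "bij_betw (\<lambda>m. (a * m + c) mod N) {..<N} {..<N}"
proof -
  have "inj_on (\<lambda>m. (a * m + c) mod N) {..<N}"
  proof (rule inj_onI)
    fix x y
    assume xy: "x \<in> {..<N}" "y \<in> {..<N}" and "(a * x + c) mod N = (a * y + c) mod N"
    then have "[a * x = a * y] (mod N)"
      by (simp add: cong_def[symmetric] cong_add_rcancel_nat)
    then have "[x = y] (mod N)"
      using assms(1) by (simp add: cong_mult_lcancel_nat)
    then show "x = y"
      using xy cong_less_modulus_unique_nat by blast
  qed
  moreover have "(\<lambda>m. (a * m + c) mod N) ` {..<N} \<subseteq> {..<N}"
    using assms(2) by auto
  ultimately show ?thesis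
    by (simp add: bij_betw_def endo_inj_surj)
qed

lemma sum_even_odd: "(\<Sum>n<2 * N. h n) = (\<Sum>m<N. h (2 * m)) + (\<Sum>m<N. h (Suc (2 * m)))"
  for h :: "nat \<Rightarrow> 'a::comm_monoid_add"
  by (induction N) (simp_all add: ac_simps)

text \<open>The Collatz map is two-to-one on residues: if \<open>3\<close> is invertible modulo \<open>N\<close>, each class
  modulo \<open>N\<close> has one even and one odd preimage modulo \<open>2 * N\<close>.\<close>

lemma sum_collatz:
  fixes h :: "nat \<Rightarrow> 'a::comm_semiring_1"
  assumes "\<And>n. h (n + N) = h n" "coprime 3 N" "0 < N"
  shows "(\<Sum>n<2 * N. h (collatz n)) = 2 * (\<Sum>n<N. h n)"
proof -
  have "(\<Sum>m<N. h (3 * m + 2)) = (\<Sum>m<N. h ((3 * m + 2) mod N))"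
    by (simp only: periodic_mod[of h, OF assms(1)])
  also have "\<dots> = (\<Sum>m<N. h m)"
    by (rule sum.reindex_bij_betw[OF bij_betw_affine_mod[OF assms(2,3)]])
  finally show ?thesis
    unfolding sum_even_odd collatz_double collatz_double_Suc by (simp add: mult_2)
qed

lemma A_op_isometry:
  assumes "f \<in> V k" "g \<in> V k"
  shows "inner_V (k + 1) (A_op k f) (A_op k g) = inner_V k f g"
proof -
  define h where "h n = f n * cnj (g n)" for n
  have "inner_V (k + 1) (A_op k f) (A_op k g)
      = (\<Sum>n<2 ^ (k + 1). A_op k f n * cnj (A_op k g n)) / 2 ^ (k + 1)"
    by (rule inner_V_eq_average[OF A_op_in_V A_op_in_V])
  also have "(\<Sum>n<2 ^ (k + 1). A_op k f n * cnj (A_op k g n)) = (\<Sum>n<2 * 2 ^ k. h (collatz n))"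
    using assms by (simp add: A_op_eq_comp h_def)
  also have "\<dots> = 2 * (\<Sum>n<2 ^ k. h n)"
    by (rule sum_collatz) (simp_all add: h_def V_antiperiodic[OF assms(1)] V_antiperiodic[OF assms(2)])
  finally show ?thesis
    using assms by (simp add: inner_V_eq_average h_def)
qed

section \<open>The adjoint of each component\<close>

lemma adjoint_on_eqI:
  assumes "z \<in> H" "\<And>x. x \<in> H \<Longrightarrow> ipK (T x) y = ipH x z"
    and "\<And>z'. z' \<in> H \<Longrightarrow> (\<And>x. x \<in> H \<Longrightarrow> ipH x z' = ipH x z) \<Longrightarrow> z' = z"
  shows "adjoint_on H ipH K ipK T y = z"
  unfolding adjoint_on_def using assms by (intro the_equality) auto

lemma A_adj_eqI:
  assumes "z \<in> V k" "\<And>x. x \<in> V k \<Longrightarrow> inner_V (k + 1) (A_op k x) y = inner_V k x z"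
  shows "A_adj k y = z"
  unfolding A_adj_def
proof (rule adjoint_on_eqI)
  fix z' assume "z' \<in> V k" and "\<And>x. x \<in> V k \<Longrightarrow> inner_V k x z' = inner_V k x z"
  then show "z' = z"
    by (rule V_eqI[OF _ assms(1)]) (simp add: Omega_in_V)
qed (use assms in auto)

text \<open>The functional \<open>x \<mapsto> \<langle>A x, y\<rangle>\<close> is represented by the vector whose coordinates are the
  conjugates of its values on the orthonormal basis.\<close>

lemma A_adj_exists:
  assumes y: "y \<in> V (k + 1)"
  shows "\<exists>z\<in>V k. \<forall>x\<in>V k. inner_V (k + 1) (A_op k x) y = inner_V k x z"
proof
  define c where "c j = inner_V (k + 1) (A_op k (Omega j k)) y" for j
  define z where "z = (\<Sum>j=1..2 ^ k. cscale (cnj (c j)) (Omega j k))"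
  show zV: "z \<in> V k"
    unfolding z_def by (intro V_sum V_scale Omega_in_V) auto
  show "\<forall>x\<in>V k. inner_V (k + 1) (A_op k x) y = inner_V k x z"
  proof
    fix x assume x: "x \<in> V k"
    have Om: "Omega j k \<in> V k" if "j \<in> {1..2 ^ k}" for j
      using that by (intro Omega_in_V) auto
    have "inner_V (k + 1) (A_op k x) y
        = (\<Sum>n<2 ^ (k + 1). \<Sum>j=1..2 ^ k. coord k j x * (Omega j k (collatz n) * cnj (y n))) / 2 ^ (k + 1)"
      unfolding inner_V_eq_average[OF A_op_in_V y]
      by (simp only: A_op_eq_comp[OF x] o_apply V_expansion[OF x] sum_distrib_right mult.assoc)
    also have "\<dots> = (\<Sum>j=1..2 ^ k. coord k j x *
        ((\<Sum>n<2 ^ (k + 1). Omega j k (collatz n) * cnj (y n)) / 2 ^ (k + 1)))"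
      by (subst sum.swap) (simp only: sum_distrib_left sum_divide_distrib times_divide_eq_right)
    also have "\<dots> = (\<Sum>j=1..2 ^ k. coord k j x * c j)"
      unfolding c_def inner_V_eq_average[OF A_op_in_V y]
      by (intro sum.cong refl) (simp only: A_op_eq_comp[OF Om] o_apply)
    also have "\<dots> = (\<Sum>j=1..2 ^ k. c j * inner_V k x (Omega j k))"
      by (intro sum.cong refl) (simp add: inner_V_Omega_right x)
    also have "\<dots> = (\<Sum>j=1..2 ^ k. c j * ((\<Sum>n<2 ^ k. x n * cnj (Omega j k n)) / 2 ^ k))"
      by (intro sum.cong refl) (simp only: inner_V_eq_average[OF x Om])
    also have "\<dots> = (\<Sum>n<2 ^ k. \<Sum>j=1..2 ^ k. c j * (x n * cnj (Omega j k n))) / 2 ^ k"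
      by (subst sum.swap) (simp only: sum_distrib_left sum_divide_distrib times_divide_eq_right)
    also have "\<dots> = inner_V k x z"
      unfolding inner_V_eq_average[OF x zV]
      by (simp add: z_def sum_fun_apply cscale_def sum_distrib_left mult_ac)
    finally show "inner_V (k + 1) (A_op k x) y = inner_V k x z" .
  qed
qed

lemma
  assumes "y \<in> V (k + 1)"
  shows A_adj_in_V: "A_adj k y \<in> V k"
    and inner_A_adj: "x \<in> V k \<Longrightarrow> inner_V (k + 1) (A_op k x) y = inner_V k x (A_adj k y)"
  using A_adj_exists[OF assms] A_adj_eqI by metis+

lemma is_adjoint_on_A_adj:
  "is_adjoint_on (V k) (inner_V k) (V (k + 1)) (inner_V (k + 1)) (A_op k) (A_adj k)"
  unfolding is_adjoint_on_def using A_op_in_V A_adj_in_V inner_A_adj by auto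

lemma A_adj_A_op: "x \<in> V k \<Longrightarrow> A_adj k (A_op k x) = x"
  by (rule A_adj_eqI) (simp_all only: A_op_isometry)

text \<open>Expanding \<open>0 \<le> \<parallel>y - A A\<^sup>* y\<parallel>\<^sup>2\<close> and using that \<open>A\<close> is isometric gives
  \<open>\<parallel>A\<^sup>* y\<parallel>\<^sup>2 \<le> \<parallel>y\<parallel>\<^sup>2\<close>.\<close>

lemma A_adj_contraction:
  assumes y: "y \<in> V (k + 1)"
  shows "(ip_norm (inner_V k) (A_adj k y))\<^sup>2 \<le> (ip_norm (inner_V (k + 1)) y)\<^sup>2"
proof -
  define z where "z = A_adj k y"
  have z: "z \<in> V k"
    unfolding z_def by (rule A_adj_in_V[OF y])
  have zy: "inner_V (k + 1) (A_op k z) y = inner_V k z z"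
    using inner_A_adj[OF y z] by (simp only: z_def)
  have yz: "Re (inner_V (k + 1) y (A_op k z)) = Re (inner_V k z z)"
    by (subst inner_V_commute) (simp only: zy cnj.simps)
  have "0 \<le> Re (inner_V (k + 1) (y - A_op k z) (y - A_op k z))"
    by (simp flip: ip_norm_sq)
  also have "\<dots> = Re (inner_V (k + 1) y y) - Re (inner_V k z z)"
    by (simp only: inner_V_diff[OF y A_op_in_V] A_op_isometry[OF z z] zy minus_complex.simps
        plus_complex.simps yz)
  finally show ?thesis
    by (simp add: ip_norm_sq z_def)
qed

section \<open>The direct sum\<close>

lemma V_inf_component: "x \<in> V_inf \<Longrightarrow> x k \<in> V k"
  by (simp add: V_inf_def)

lemma V_inf_summable: "x \<in> V_inf \<Longrightarrow> summable (\<lambda>k. (ip_norm (inner_V k) (x k))\<^sup>2)"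
  by (simp add: V_inf_def)

lemma summable_inner_V:
  assumes "x \<in> V_inf" "y \<in> V_inf"
  shows "summable (\<lambda>k. inner_V k (x k) (y k))"
  by (rule summable_comparison_test'[OF summable_add[OF assms[THEN V_inf_summable]]])
     (rule norm_inner_V_le)

lemma V_inf_diff:
  assumes "x \<in> V_inf" "y \<in> V_inf"
  shows "x - y \<in> V_inf"
proof -
  have bound: "(ip_norm (inner_V k) (x k - y k))\<^sup>2
      \<le> 2 * (ip_norm (inner_V k) (x k))\<^sup>2 + 2 * (ip_norm (inner_V k) (y k))\<^sup>2" for k
  proof -
    have sq: "(cmod (a - b))\<^sup>2 \<le> 2 * (cmod a)\<^sup>2 + 2 * (cmod b)\<^sup>2" for a b
    proof -
      have "(cmod (a - b))\<^sup>2 \<le> (cmod a + cmod b)\<^sup>2"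
        by (intro power_mono norm_triangle_ineq4) simp
      also have "\<dots> \<le> 2 * (cmod a)\<^sup>2 + 2 * (cmod b)\<^sup>2"
        using sum_squares_bound[of "cmod a" "cmod b"] by (simp add: power2_sum)
      finally show ?thesis .
    qed
    have "(\<Sum>n<2 ^ k. (cmod (x k n - y k n))\<^sup>2)
        \<le> (\<Sum>n<2 ^ k. 2 * (cmod (x k n))\<^sup>2 + 2 * (cmod (y k n))\<^sup>2)"
      by (intro sum_mono sq)
    also have "\<dots> = 2 * (\<Sum>n<2 ^ k. (cmod (x k n))\<^sup>2) + 2 * (\<Sum>n<2 ^ k. (cmod (y k n))\<^sup>2)"
      by (simp only: sum.distrib sum_distrib_left)
    finally have "(\<Sum>n<2 ^ k. (cmod (x k n - y k n))\<^sup>2) / 2 ^ k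
        \<le> (2 * (\<Sum>n<2 ^ k. (cmod (x k n))\<^sup>2) + 2 * (\<Sum>n<2 ^ k. (cmod (y k n))\<^sup>2)) / 2 ^ k"
      by (rule divide_right_mono) simp
    then show ?thesis
      using V_inf_component[OF assms(1), of k] V_inf_component[OF assms(2), of k]
      by (simp add: ip_norm_sq_eq_average V_diff add_divide_distrib)
  qed
  have "summable (\<lambda>k. (ip_norm (inner_V k) (x k - y k))\<^sup>2)"
    by (rule summable_comparison_test'[OF summable_add[OF
        assms[THEN V_inf_summable, THEN summable_mult]]]) (use bound in simp)
  then show ?thesis
    using assms by (simp add: V_inf_def V_diff)
qed

lemma S_op_0: "S_op x 0 = 0"
  by (simp add: S_op_def)

lemma S_op_Suc: "S_op x (Suc k) = A_op k (x k)"
  by (simp add: S_op_def)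

lemma S_op_in_V_inf:
  assumes "x \<in> V_inf"
  shows "S_op x \<in> V_inf"
proof -
  have "(ip_norm (inner_V (Suc k)) (S_op x (Suc k)))\<^sup>2 = (ip_norm (inner_V k) (x k))\<^sup>2" for k
    using A_op_isometry[OF V_inf_component[OF assms] V_inf_component[OF assms], of k]
    by (simp add: ip_norm_sq S_op_Suc)
  then have "summable (\<lambda>k. (ip_norm (inner_V (Suc k)) (S_op x (Suc k)))\<^sup>2)"
    using V_inf_summable[OF assms] by simp
  then have "summable (\<lambda>k. (ip_norm (inner_V k) (S_op x k))\<^sup>2)"
    by (subst (asm) summable_Suc_iff)
  moreover have "S_op x k \<in> V k" for k
    using A_op_in_V by (cases k) (auto simp: S_op_0 S_op_Suc V_zero)
  ultimately show ?thesis
    by (simp add: V_inf_def)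
qed

lemma inner_inf_S_op:
  assumes "x \<in> V_inf" "y \<in> V_inf"
  shows "inner_inf (S_op x) y = (\<Sum>k. inner_V (k + 1) (A_op k (x k)) (y (k + 1)))"
proof -
  have "inner_V 0 (S_op x 0) (y 0) = 0"
    using V_inf_component[OF assms(2), of 0] by (simp add: S_op_0 inner_V_eq_average V_zero)
  then show ?thesis
    using suminf_split_head[OF summable_inner_V[OF S_op_in_V_inf[OF assms(1)] assms(2)]]
    by (simp add: inner_inf_def S_op_Suc)
qed

lemma inner_inf_S_op_S_op:
  assumes "x \<in> V_inf" "y \<in> V_inf"
  shows "inner_inf (S_op x) (S_op y) = inner_inf x y"
  unfolding inner_inf_S_op[OF assms(1) S_op_in_V_inf[OF assms(2)]]
  using A_op_isometry[OF V_inf_component[OF assms(1)] V_inf_component[OF assms(2)]]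
  by (simp add: inner_inf_def S_op_Suc)

text \<open>Vectors of the direct sum are told apart by pairing them with the sequences that have a
  single nonzero entry, a basis function.\<close>

lemma V_inf_eqI:
  assumes y: "y \<in> V_inf" and z: "z \<in> V_inf"
    and eq: "\<And>x. x \<in> V_inf \<Longrightarrow> inner_inf x y = inner_inf x z"
  shows "y = z"
proof
  fix k
  show "y k = z k"
  proof (rule V_eqI)
    show "y k \<in> V k" "z k \<in> V k"
      using y z by (simp_all add: V_inf_component)
    fix j :: nat assume j: "j \<in> {1..2 ^ k}"
    define e where "e i = (if i = k then Omega j k else 0)" for i :: nat
    have inner_zero: "inner_V i 0 f = 0" if "f \<in> V i" for i f
      using that by (simp add: inner_V_eq_average V_zero)
    have "summable (\<lambda>i. (ip_norm (inner_V i) (e i))\<^sup>2)"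
      by (rule summable_finite[of "{k}"]) (simp_all add: e_def ip_norm_sq inner_zero V_zero)
    then have "e \<in> V_inf"
      using j by (auto simp: V_inf_def e_def V_zero intro: Omega_in_V)
    moreover have "inner_inf e w = inner_V k (Omega j k) (w k)" if "w \<in> V_inf" for w
      unfolding inner_inf_def using V_inf_component[OF that]
      by (subst suminf_finite[of "{k}"]) (simp_all add: e_def inner_zero)
    ultimately show "inner_V k (Omega j k) (y k) = inner_V k (Omega j k) (z k)"
      using eq y z by metis
  qed
qed

lemma A_adj_sequence_in_V_inf:
  assumes "y \<in> V_inf"
  shows "(\<lambda>k. A_adj k (y (k + 1))) \<in> V_inf"
proof -
  have "summable (\<lambda>k. (ip_norm (inner_V (Suc k)) (y (Suc k)))\<^sup>2)"
    by (subst summable_Suc_iff) (rule V_inf_summable[OF assms])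
  then have "summable (\<lambda>k. (ip_norm (inner_V k) (A_adj k (y (k + 1))))\<^sup>2)"
    by (rule summable_comparison_test')
       (use A_adj_contraction[OF V_inf_component[OF assms]] in simp)
  then show ?thesis
    using A_adj_in_V[OF V_inf_component[OF assms]] by (simp add: V_inf_def)
qed

lemma inner_inf_A_adj_sequence:
  assumes "x \<in> V_inf" "y \<in> V_inf"
  shows "inner_inf (S_op x) y = inner_inf x (\<lambda>k. A_adj k (y (k + 1)))"
  unfolding inner_inf_S_op[OF assms]
  using inner_A_adj[OF V_inf_component[OF assms(2)] V_inf_component[OF assms(1)]]
  by (simp add: inner_inf_def)

lemma S_adj_eq:
  assumes "y \<in> V_inf"
  shows "S_adj y = (\<lambda>k. A_adj k (y (k + 1)))"
  unfolding S_adj_def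
proof (rule adjoint_on_eqI)
  show in_V_inf: "(\<lambda>k. A_adj k (y (k + 1))) \<in> V_inf"
    by (rule A_adj_sequence_in_V_inf[OF assms])
  show "inner_inf (S_op x) y = inner_inf x (\<lambda>k. A_adj k (y (k + 1)))" if "x \<in> V_inf" for x
    by (rule inner_inf_A_adj_sequence[OF that assms])
  show "z = (\<lambda>k. A_adj k (y (k + 1)))"
    if "z \<in> V_inf" and "\<And>x. x \<in> V_inf \<Longrightarrow> inner_inf x z = inner_inf x (\<lambda>k. A_adj k (y (k + 1)))" for z
    by (rule V_inf_eqI[OF that(1) in_V_inf that(2)])
qed

lemma S_op_add:
  assumes "x \<in> V_inf" "y \<in> V_inf"
  shows "S_op (x + y) = S_op x + S_op y"
proof
  fix k show "S_op (x + y) k = (S_op x + S_op y) k"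
    using assms by (cases k) (simp_all add: S_op_0 S_op_Suc A_op_add V_inf_component)
qed

lemma S_op_diff:
  assumes "x \<in> V_inf" "y \<in> V_inf"
  shows "S_op (x - y) = S_op x - S_op y"
proof
  fix k show "S_op (x - y) k = (S_op x - S_op y) k"
    using assms by (cases k) (simp_all add: S_op_0 S_op_Suc A_op_diff V_inf_component)
qed

lemma S_op_scale:
  assumes "x \<in> V_inf"
  shows "S_op (scale_inf c x) = scale_inf c (S_op x)"
proof
  fix k show "S_op (scale_inf c x) k = scale_inf c (S_op x) k"
    using assms by (cases k) (simp_all add: S_op_0 S_op_Suc scale_inf_def A_op_scale V_inf_component)
qed

lemma isometric_embedding_S_op:
  "isometric_embedding_on V_inf scale_inf inner_inf V_inf scale_inf inner_inf S_op"
proof -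
  have "ip_norm inner_inf (S_op x - S_op y) = ip_norm inner_inf (x - y)"
    if "x \<in> V_inf" "y \<in> V_inf" for x y
    using that by (simp add: ip_norm_def inner_inf_S_op_S_op V_inf_diff flip: S_op_diff)
  then show ?thesis
    unfolding isometric_embedding_on_def linear_on_def
    by (auto simp: S_op_in_V_inf S_op_add S_op_scale)
qed

theorem theorem8p11:
  shows "S_op \<in> V_inf \<rightarrow> V_inf \<and>
    (\<forall>k. is_adjoint_on (V k) (inner_V k) (V (k + 1)) (inner_V (k + 1)) (A_op k) (A_adj k)) \<and>
    (is_adjoint_on V_inf inner_inf V_inf inner_inf S_op S_adj \<and>
      (\<forall>x\<in>V_inf. S_adj x = (\<lambda>k. A_adj k (x (k + 1))))) \<and>
    (\<forall>x\<in>V_inf. S_adj (S_op x) = x) \<and>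
    isometric_embedding_on V_inf scale_inf inner_inf V_inf scale_inf inner_inf S_op"
proof (intro conjI allI ballI)
  show "S_op \<in> V_inf \<rightarrow> V_inf"
    by (auto intro: S_op_in_V_inf)
  show "is_adjoint_on (V k) (inner_V k) (V (k + 1)) (inner_V (k + 1)) (A_op k) (A_adj k)" for k
    by (rule is_adjoint_on_A_adj)
  show "is_adjoint_on V_inf inner_inf V_inf inner_inf S_op S_adj"
    unfolding is_adjoint_on_def
  proof (intro conjI ballI funcsetI)
    fix x y assume x: "x \<in> V_inf" and y: "y \<in> V_inf"
    show "S_op x \<in> V_inf"
      by (rule S_op_in_V_inf[OF x])
    show "S_adj y \<in> V_inf"
      unfolding S_adj_eq[OF y] by (rule A_adj_sequence_in_V_inf[OF y])
    show "inner_inf (S_op x) y = inner_inf x (S_adj y)"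
      unfolding S_adj_eq[OF y] by (rule inner_inf_A_adj_sequence[OF x y])
  qed
  show "S_adj x = (\<lambda>k. A_adj k (x (k + 1)))" if "x \<in> V_inf" for x
    using that by (rule S_adj_eq)
  show "S_adj (S_op x) = x" if "x \<in> V_inf" for x
    using that by (simp add: S_adj_eq S_op_in_V_inf S_op_Suc A_adj_A_op V_inf_component)
  show "isometric_embedding_on V_inf scale_inf inner_inf V_inf scale_inf inner_inf S_op"
    by (rule isometric_embedding_S_op)
qed

end
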